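(* Fix parameters $\theta$, a batch of $M$ prompts $x_1,\dots,x_M$, a grouping map $g$ assigning each prompt a bin in $\{1,\dots,B\}$, and positive integer rollout counts $\mathbf n=(n_1,\dots,n_B)$. Let $\bar q_b=\frac{1}{M}\sum_{i=1}^M \mathbf{1}\{g(x_i)=b\}$, and let $$\hat g(\theta;\mathbf n)=\frac{1}{M}\sum_{i=1}^M \hat g(x_i;\theta,n_{g(x_i)})$$ be the batch gradient estimator. Assume that, conditioned on the batch prompts $\{x_i\}_{i=1}^M$, the rollout groups used to form the per-prompt estimators $\hat g(x_i;\theta,n_{g(x_i)})$ are independent across $i$. Let $v_b(\theta)$, $b=1,\dots,B$, be any constants such that $$\mathbb{E}\big[\|\hat g(x;\theta,n_b)-\mathbb{E}[\hat g(x;\theta,n_b)\mid x]\|_2^2\mid x\big]\le \frac{v_b(\theta)}{n_b}\quad\text{for all prompts } x \text{ with } g(x)=b.$$ Then $$\mathbb{E}\!\left[\big\|\hat g(\theta;\mathbf n)-\mathbb{E}[\hat g(\theta;\mathbf n)\mid \{x_i\}_{i=1}^M]\big\|_2^2 \,\Big|\, \{x_i\}_{i=1}^M\right]\;\le\;\frac{1}{M}\sum_{b=1}^B \bar q_b\,\frac{v_b(\theta)}{n_b}.$$ Moreover, if the rollout sampling model and the bounded-differences condition described in the context hold with constants $C_b(\theta)$, one may take $v_b(\theta)=C_b(\theta)^2/2$.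
   Context: For a prompt $x$ with $g(x)=b$, one samples a rollout group $(y_1,\dots,y_{n_b})$ of random responses, and $\hat g(x;\theta,n_b)\in\mathbb{R}^d$ is a random vector that is a function of this rollout group (it is the gradient $\nabla_\theta\hat\ell(x;\theta,n_b)$ of a prompt-level empirical loss formed from the group). Rollout sampling model: conditional on $x$ and $\theta$, the rollouts $y_1,\dots,y_{n_b}$ are drawn i.i.d. from a distribution $\pi_\theta(\cdot\mid x)$; $\hat\ell(x;\theta,n_b)$ is differentiable in $\theta$ and $\nabla_\theta\mathbb{E}[\hat\ell(x;\theta,n_b)\mid x]=\mathbb{E}[\nabla_\theta\hat\ell(x;\theta,n_b)\mid x]$. Bounded-differences condition: for any $x$ with $g(x)=b$ and any rollout count $n_b$, $\hat g(x;\theta,n_b)$ is a measurable function of $(y_1,\dots,y_{n_b})$, and there is a constant $C_b(\theta)\ge 0$ (depending only on the bin and $\theta$) such that for every $j\in\{1,\dots,n_b\}$ and any replacement rollout $y_j'$, $$\big\|\hat g(x;\theta,n_b;y_1,\dots,y_j,\dots,y_{n_b})-\hat g(x;\theta,n_b;y_1,\dots,y_j',\dots,y_{n_b})\big\|_2\le \frac{C_b(\theta)}{n_b}.$$ *)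

theory Defs
  imports "HOL-Probability.Probability"
begin

text \<open>
  Types: \<open>'p\<close> prompts, \<open>'r\<close> single rollouts, \<open>real ^ 'd\<close> parameters and gradients.
  A rollout group of size \<open>m\<close> is a point \<open>(y 1, \<dots>, y m)\<close> of the product space below.
\<close>

definition group_space :: "'r measure \<Rightarrow> nat \<Rightarrow> (nat \<Rightarrow> 'r) measure" where
  "group_space R m = PiM {1..m} (\<lambda>_. R)"

text \<open>The gradient as a function; it is unspecified where \<open>f\<close> is not differentiable.\<close>

definition grad :: "('a::real_inner \<Rightarrow> real) \<Rightarrow> 'a \<Rightarrow> 'a" where
  "grad f \<theta> = (THE D. GDERIV f \<theta> :> D)"

text \<open>
  \<open>loss x \<theta> m y\<close> is the empirical loss of prompt \<open>x\<close> formed from the group \<open>y\<close> of size \<open>m\<close>.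
\<close>

definition ghat ::
  "('p \<Rightarrow> real ^ 'd \<Rightarrow> nat \<Rightarrow> (nat \<Rightarrow> 'r) \<Rightarrow> real) \<Rightarrow> 'p \<Rightarrow> real ^ 'd \<Rightarrow> nat \<Rightarrow> (nat \<Rightarrow> 'r) \<Rightarrow> real ^ 'd"
  where "ghat loss x \<theta> m y = grad (\<lambda>t. loss x t m y) \<theta>"

definition mean_sq_dev :: "'w measure \<Rightarrow> ('w \<Rightarrow> real ^ 'd) \<Rightarrow> real" where
  "mean_sq_dev P Z = (\<integral>w. (norm (Z w - (\<integral>u. Z u \<partial>P)))\<^sup>2 \<partial>P)"

text \<open>
  The inequality \<open>E \<parallel>Z - E Z\<parallel>\<^sup>2 \<le> c\<close> with its left-hand side read as a genuine, finite
  expectation. The square-integrability clause is needed because the Bochner integral of a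
  non-integrable function is \<open>0\<close>; on a probability space it also makes \<open>Z\<close> integrable.
\<close>

definition variance_le :: "'w measure \<Rightarrow> ('w \<Rightarrow> real ^ 'd) \<Rightarrow> real \<Rightarrow> bool" where
  "variance_le P Z c \<longleftrightarrow>
     Z \<in> borel_measurable P \<and> integrable P (\<lambda>w. (norm (Z w))\<^sup>2) \<and> mean_sq_dev P Z \<le> c"

definition bin_freq :: "nat \<Rightarrow> ('p \<Rightarrow> nat) \<Rightarrow> (nat \<Rightarrow> 'p) \<Rightarrow> nat \<Rightarrow> real" where
  "bin_freq M g xs b = (1 / real M) * (\<Sum>i=1..M. if g (xs i) = b then 1 else 0)"

text \<open>\<open>Y i w\<close> is the group sampled for the \<open>i\<close>-th prompt of the batch, at outcome \<open>w\<close>.\<close>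

definition batch_grad ::
  "('p \<Rightarrow> real ^ 'd \<Rightarrow> nat \<Rightarrow> (nat \<Rightarrow> 'r) \<Rightarrow> real) \<Rightarrow> nat \<Rightarrow> ('p \<Rightarrow> nat) \<Rightarrow> (nat \<Rightarrow> 'p) \<Rightarrow> real ^ 'd
     \<Rightarrow> (nat \<Rightarrow> nat) \<Rightarrow> (nat \<Rightarrow> 'w \<Rightarrow> nat \<Rightarrow> 'r) \<Rightarrow> 'w \<Rightarrow> real ^ 'd" where
  "batch_grad loss M g xs \<theta> n Y w =
     (1 / real M) *\<^sub>R (\<Sum>i=1..M. ghat loss (xs i) \<theta> (n (g (xs i))) (Y i w))"

text \<open>
  \<open>Q \<theta> x m\<close> is the conditional law, given \<open>x\<close> and \<open>\<theta>\<close>, of a rollout group of size \<open>m\<close>, so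
  \<open>E[f | x]\<close> is the integral of \<open>f\<close> with respect to it.
\<close>

definition group_law :: "'r measure \<Rightarrow> ('t \<Rightarrow> 'p \<Rightarrow> nat \<Rightarrow> (nat \<Rightarrow> 'r) measure) \<Rightarrow> bool" where
  "group_law R Q \<longleftrightarrow>
     (\<forall>\<theta> x m. 0 < m \<longrightarrow> prob_space (Q \<theta> x m) \<and> sets (Q \<theta> x m) = sets (group_space R m))"

text \<open>
  The sampling law in the expected loss moves with the parameter: the differentiated function is
  \<open>t \<mapsto> E[loss x t m]\<close> with the rollouts drawn from \<open>\<pi> t x\<close>.
\<close>

definition rollout_sampling_model ::
  "'r measure \<Rightarrow> (real ^ 'd \<Rightarrow> 'p \<Rightarrow> 'r measure) \<Rightarrow> (real ^ 'd \<Rightarrow> 'p \<Rightarrow> nat \<Rightarrow> (nat \<Rightarrow> 'r) measure)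
     \<Rightarrow> ('p \<Rightarrow> real ^ 'd \<Rightarrow> nat \<Rightarrow> (nat \<Rightarrow> 'r) \<Rightarrow> real) \<Rightarrow> real ^ 'd \<Rightarrow> bool" where
  "rollout_sampling_model R \<pi> Q loss \<theta> \<longleftrightarrow>
     (\<forall>t x. prob_space (\<pi> t x) \<and> sets (\<pi> t x) = sets R) \<and>
     (\<forall>t x m. 0 < m \<longrightarrow> Q t x m = PiM {1..m} (\<lambda>_. \<pi> t x)) \<and>
     (\<forall>x m. 0 < m \<longrightarrow>
        (\<forall>y \<in> space (group_space R m). (\<lambda>t. loss x t m y) differentiable (at \<theta>)) \<and>
        (\<forall>\<^sub>F t in nhds \<theta>. integrable (Q t x m) (loss x t m)) \<and>
        integrable (Q \<theta> x m) (ghat loss x \<theta> m) \<and>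
        GDERIV (\<lambda>t. \<integral>y. loss x t m y \<partial>Q t x m) \<theta> :> (\<integral>y. ghat loss x \<theta> m y \<partial>Q \<theta> x m))"

definition bounded_differences ::
  "'r measure \<Rightarrow> ('p \<Rightarrow> real ^ 'd \<Rightarrow> nat \<Rightarrow> (nat \<Rightarrow> 'r) \<Rightarrow> real) \<Rightarrow> ('p \<Rightarrow> nat) \<Rightarrow> real ^ 'd
     \<Rightarrow> nat \<Rightarrow> real \<Rightarrow> bool" where
  "bounded_differences R loss g \<theta> b c \<longleftrightarrow>
     0 \<le> c \<and>
     (\<forall>x m. g x = b \<longrightarrow> 0 < m \<longrightarrow>
        ghat loss x \<theta> m \<in> borel_measurable (group_space R m) \<and>
        (\<forall>y \<in> space (group_space R m). \<forall>j \<in> {1..m}. \<forall>y' \<in> space R.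
           norm (ghat loss x \<theta> m y - ghat loss x \<theta> m (y(j := y'))) \<le> c / real m))"

end

theory Submission
  imports Defs
begin

text \<open>
  For independent random vectors the cross terms of \<open>\<parallel>\<Sum>\<^sub>i (Z\<^sub>i - E Z\<^sub>i)\<parallel>\<^sup>2\<close> have mean zero, so the variance
  of the batch gradient is \<open>1/M\<^sup>2\<close> times the sum of the variances of the per-prompt gradients;
  sorting the prompts by bin gives the bound.
  For the constants \<open>C\<^sub>b\<^sup>2 / 2\<close> one needs the Efron--Stein inequality for vectors, with bounded
  differences \<open>c\<^sub>j\<close>: the variance is at most \<open>\<Sum>\<^sub>j c\<^sub>j\<^sup>2 / 2\<close>. Splitting off one coordinate
  \<open>y\<close>, the law of total variance writes the variance as the mean of the variance in \<open>y\<close>,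
  at most \<open>c\<^sup>2 / 2\<close> since \<open>2 Var Z = E \<parallel>Z - Z'\<parallel>\<^sup>2\<close> for an independent copy \<open>Z'\<close>, plus the variance of the
  mean over \<open>y\<close>, which inherits the remaining bounded differences.
\<close>

section \<open>Square-integrable random vectors and their second moments\<close>

lemma integrable_inner_of_square_integrable:
  fixes Z W :: "'a \<Rightarrow> 'b::euclidean_space"
  assumes [measurable]: "Z \<in> borel_measurable M" "W \<in> borel_measurable M"
    and "integrable M (\<lambda>x. (norm (Z x))\<^sup>2)" "integrable M (\<lambda>x. (norm (W x))\<^sup>2)"
  shows "integrable M (\<lambda>x. Z x \<bullet> W x)"
proof (rule Bochner_Integration.integrable_bound)
  show "integrable M (\<lambda>x. (norm (Z x))\<^sup>2 + (norm (W x))\<^sup>2)"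
    using assms by simp
  have "\<bar>Z x \<bullet> W x\<bar> \<le> (norm (Z x))\<^sup>2 + (norm (W x))\<^sup>2" for x
  proof -
    have "\<bar>Z x \<bullet> W x\<bar> \<le> norm (Z x) * norm (W x)"
      by (rule Cauchy_Schwarz_ineq2)
    also have "\<dots> \<le> (norm (Z x))\<^sup>2 + (norm (W x))\<^sup>2"
      using sum_squares_bound[of "norm (Z x)" "norm (W x)"]
        mult_nonneg_nonneg[OF norm_ge_zero[of "Z x"] norm_ge_zero[of "W x"]] by linarith
    finally show ?thesis .
  qed
  then show "AE x in M. norm (Z x \<bullet> W x) \<le> norm ((norm (Z x))\<^sup>2 + (norm (W x))\<^sup>2)"
    by simp
qed measurable

lemma square_integrable_sum:
  fixes Z :: "'i \<Rightarrow> 'a \<Rightarrow> 'b::euclidean_space"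
  assumes "\<And>i. i \<in> I \<Longrightarrow> Z i \<in> borel_measurable M"
    and "\<And>i. i \<in> I \<Longrightarrow> integrable M (\<lambda>x. (norm (Z i x))\<^sup>2)"
  shows "integrable M (\<lambda>x. (norm (\<Sum>i\<in>I. Z i x))\<^sup>2)"
  unfolding power2_norm_eq_inner inner_sum_left inner_sum_right
  using assms by (intro Bochner_Integration.integrable_sum integrable_inner_of_square_integrable)

context prob_space
begin

lemma integrable_of_square_integrable:
  fixes Z :: "'a \<Rightarrow> 'b::euclidean_space"
  assumes [measurable]: "Z \<in> borel_measurable M" and "integrable M (\<lambda>x. (norm (Z x))\<^sup>2)"
  shows "integrable M Z"
  using square_integrable_imp_integrable[of "\<lambda>x. norm (Z x)"] assms
  by (simp add: integrable_norm_iff)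

lemma square_integrable_diff_const:
  fixes Z :: "'a \<Rightarrow> 'b::euclidean_space"
  assumes Z: "Z \<in> borel_measurable M" and sq: "integrable M (\<lambda>x. (norm (Z x))\<^sup>2)"
  shows "integrable M (\<lambda>x. (norm (Z x - a))\<^sup>2)"
proof -
  note int = integrable_of_square_integrable[OF Z sq]
  have "(norm (z - a))\<^sup>2 = (norm z)\<^sup>2 - 2 * (z \<bullet> a) + (norm a)\<^sup>2" for z
    by (simp add: power2_norm_eq_inner algebra_simps inner_commute)
  then show ?thesis
    using int sq by simp
qed

text \<open>Expanding the square turns the integral into a quadratic expression in \<open>a\<close>.
  It is applied with \<open>a\<close> the mean, which gives the usual variance formula, and with
  \<open>a = Z y\<close>, the value of \<open>Z\<close> at a second point.\<close>

lemma mean_sq_diff_const: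
  fixes Z :: "'a \<Rightarrow> 'b::euclidean_space"
  assumes Z: "Z \<in> borel_measurable M" and sq: "integrable M (\<lambda>x. (norm (Z x))\<^sup>2)"
  shows "(\<integral>x. (norm (Z x - a))\<^sup>2 \<partial>M) =
    (\<integral>x. (norm (Z x))\<^sup>2 \<partial>M) - 2 * (expectation Z \<bullet> a) + (norm a)\<^sup>2"
proof -
  note int = integrable_of_square_integrable[OF Z sq]
  have *: "(norm (z - a))\<^sup>2 = (norm z)\<^sup>2 - 2 * (z \<bullet> a) + (norm a)\<^sup>2" for z
    by (simp add: power2_norm_eq_inner algebra_simps inner_commute)
  have "(\<integral>x. Z x \<bullet> a \<partial>M) = expectation Z \<bullet> a"
    using int by (cases "a = 0") auto
  then show ?thesis
    using int sq unfolding * by (simp add: prob_space)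
qed

section \<open>Variance of a sum of independent vectors\<close>

text \<open>The product formula for independent real variables is applied in each coordinate:
  \<open>Z i x \<bullet> e\<close> and \<open>Z j x \<bullet> e\<close> are independent for every
  basis vector \<open>e\<close>, and the inner product is the sum of their products over
  \<open>Basis\<close>. Restricting the family to the two distinct indices makes the general product
  formula one with two factors.\<close>

lemma expectation_inner_indep:
  fixes Z :: "'i \<Rightarrow> 'a \<Rightarrow> 'b::euclidean_space"
  assumes indep: "indep_vars (\<lambda>_. borel) Z I" and ij: "i \<in> I" "j \<in> I" "i \<noteq> j"
    and int: "integrable M (Z i)" "integrable M (Z j)"
  shows "expectation (\<lambda>x. Z i x \<bullet> Z j x) = expectation (Z i) \<bullet> expectation (Z j)"
proof -
  have comp: "integrable M (\<lambda>x. (Z i x \<bullet> e) * (Z j x \<bullet> e)) \<and>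
      expectation (\<lambda>x. (Z i x \<bullet> e) * (Z j x \<bullet> e)) = (expectation (Z i) \<bullet> e) * (expectation (Z j) \<bullet> e)"
    if e: "e \<in> Basis" for e
  proof -
    have "indep_vars (\<lambda>_. borel) Z {i, j}"
      using indep ij by (auto intro: indep_vars_subset)
    then have *: "indep_vars (\<lambda>_. borel) (\<lambda>k x. Z k x \<bullet> e) {i, j}"
      by (rule indep_vars_compose2) auto
    have i: "integrable M (\<lambda>x. Z k x \<bullet> e)" if "k \<in> {i, j}" for k
      using that int by auto
    show ?thesis
      using indep_vars_lebesgue_integral[OF _ * i] indep_vars_integrable[OF _ * i] ij int
        nonzero_Basis[OF e] by simp
  qed
  have "expectation (\<lambda>x. Z i x \<bullet> Z j x) = (\<Sum>e\<in>Basis. expectation (\<lambda>x. (Z i x \<bullet> e) * (Z j x \<bullet> e)))"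
    by (subst euclidean_inner) (use comp in simp)
  also have "\<dots> = expectation (Z i) \<bullet> expectation (Z j)"
    by (subst euclidean_inner) (use comp in simp)
  finally show ?thesis .
qed

lemma mean_sq_dev_sum_indep:
  fixes Z :: "'i \<Rightarrow> 'a \<Rightarrow> 'b::euclidean_space"
  assumes indep: "indep_vars (\<lambda>_. borel) Z I" and "finite I"
    and sq: "\<And>i. i \<in> I \<Longrightarrow> integrable M (\<lambda>x. (norm (Z i x))\<^sup>2)"
  shows "(\<integral>x. (norm ((\<Sum>i\<in>I. Z i x) - (\<integral>u. (\<Sum>i\<in>I. Z i u) \<partial>M)))\<^sup>2 \<partial>M) =
    (\<Sum>i\<in>I. \<integral>x. (norm (Z i x - expectation (Z i)))\<^sup>2 \<partial>M)"
proof -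
  define W where "W i x = Z i x - expectation (Z i)" for i x
  have Z: "Z i \<in> borel_measurable M" if "i \<in> I" for i
    using indep that by (auto simp: indep_vars_def)
  have int: "integrable M (Z i)" if "i \<in> I" for i
    by (rule integrable_of_square_integrable[OF Z[OF that] sq[OF that]])
  have W: "W i \<in> borel_measurable M" if "i \<in> I" for i
    unfolding W_def using Z[OF that] by measurable
  have Wint: "integrable M (W i)" and W0: "expectation (W i) = 0" if "i \<in> I" for i
    unfolding W_def using int[OF that] by (simp_all add: prob_space)
  have Wsq: "integrable M (\<lambda>x. (norm (W i x))\<^sup>2)" if "i \<in> I" for i
    unfolding W_def by (rule square_integrable_diff_const[OF Z[OF that] sq[OF that]])
  have WW: "integrable M (\<lambda>x. W i x \<bullet> W j x)" if "i \<in> I" "j \<in> I" for i j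
    using that by (intro integrable_inner_of_square_integrable W Wsq)
  have Windep: "indep_vars (\<lambda>_. borel) W I"
    unfolding W_def by (rule indep_vars_compose2[OF indep]) measurable
  have "(\<integral>x. (norm ((\<Sum>i\<in>I. Z i x) - (\<integral>u. (\<Sum>i\<in>I. Z i u) \<partial>M)))\<^sup>2 \<partial>M) = (\<integral>x. (norm (\<Sum>i\<in>I. W i x))\<^sup>2 \<partial>M)"
    using int by (simp add: W_def sum_subtractf)
  also have "\<dots> = (\<integral>x. (\<Sum>i\<in>I. \<Sum>j\<in>I. W i x \<bullet> W j x) \<partial>M)"
    unfolding power2_norm_eq_inner inner_sum_left unfolding inner_sum_right ..
  also have "\<dots> = (\<Sum>i\<in>I. \<Sum>j\<in>I. \<integral>x. W i x \<bullet> W j x \<partial>M)"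
    using WW by simp
  \<comment> \<open>For \<open>i \<noteq> j\<close> independence factors the mean of the inner
    product into an inner product of means, and the centred vectors \<open>W i\<close> have mean
    zero; only the diagonal survives.\<close>
  also have "\<dots> = (\<Sum>i\<in>I. \<Sum>j\<in>I. if j = i then \<integral>x. W i x \<bullet> W i x \<partial>M else 0)"
    using expectation_inner_indep[OF Windep] Wint W0 by (intro sum.cong) auto
  also have "\<dots> = (\<Sum>i\<in>I. \<integral>x. (norm (W i x))\<^sup>2 \<partial>M)"
    using \<open>finite I\<close> by (simp add: power2_norm_eq_inner)
  finally show ?thesis
    by (simp add: W_def)
qed

section \<open>Efron-Stein inequality for vectors with bounded differences\<close>

text \<open>The independent copy is realised by integrating twice over the same space. For fixed
  \<open>y\<close> the mean over \<open>x\<close> of the squared distance from \<open>Z x\<close> to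
  \<open>Z y\<close> is at most \<open>c\<^sup>2\<close>; averaging its expansion over
  \<open>y\<close> yields twice the variance.\<close>

lemma mean_sq_dev_le_of_bounded_difference:
  fixes Z :: "'a \<Rightarrow> 'b::euclidean_space"
  assumes Z: "Z \<in> borel_measurable M" and sq: "integrable M (\<lambda>x. (norm (Z x))\<^sup>2)"
    and diff: "\<And>x y. x \<in> space M \<Longrightarrow> y \<in> space M \<Longrightarrow> norm (Z x - Z y) \<le> c"
  shows "(\<integral>x. (norm (Z x))\<^sup>2 \<partial>M) - (norm (expectation Z))\<^sup>2 \<le> c\<^sup>2 / 2"
proof -
  note int = integrable_of_square_integrable[OF Z sq]
  let ?S = "\<integral>x. (norm (Z x))\<^sup>2 \<partial>M"
  have le: "?S - 2 * (expectation Z \<bullet> Z y) + (norm (Z y))\<^sup>2 \<le> c\<^sup>2" if "y \<in> space M" for y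
    unfolding mean_sq_diff_const[OF Z sq, symmetric]
    using that by (intro integral_le_const square_integrable_diff_const Z sq AE_I2 power_mono diff) auto
  have "(\<integral>y. ?S - 2 * (expectation Z \<bullet> Z y) + (norm (Z y))\<^sup>2 \<partial>M) \<le> c\<^sup>2"
    using le int sq by (intro integral_le_const AE_I2) auto
  moreover have "(\<integral>y. expectation Z \<bullet> Z y \<partial>M) = expectation Z \<bullet> expectation Z"
    using int by (cases "expectation Z = 0") auto
  ultimately show ?thesis
    using int sq by (simp add: prob_space power2_norm_eq_inner)
qed

end

text \<open>Moving the coordinates one after another to fixed points changes \<open>Z\<close> by at
  most the sum of the \<open>c j\<close>, and ends at a single value. This is how bounded
  differences supply integrability in the Efron-Stein argument.\<close>

lemma bounded_on_PiE_of_bounded_differences: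
  fixes Z :: "('i \<Rightarrow> 'a) \<Rightarrow> 'b::real_normed_vector"
  assumes "finite I" and nonempty: "\<And>i. S i \<noteq> {}"
    and "\<And>y j y'. y \<in> PiE I S \<Longrightarrow> j \<in> I \<Longrightarrow> y' \<in> S j \<Longrightarrow> norm (Z y - Z (y(j := y'))) \<le> c j"
  shows "\<exists>K. \<forall>y \<in> PiE I S. norm (Z y) \<le> K"
  using assms(1,3)
proof (induction I arbitrary: Z rule: finite_induct)
  case empty
  then show ?case by auto
next
  case (insert i I)
  obtain a where a: "a \<in> S i"
    using nonempty by blast
  \<comment> \<open>The section of \<open>Z\<close> with coordinate \<open>i\<close> frozen at
    \<open>a\<close> inherits the bounded differences in the other coordinates, since updates at
    distinct indices commute.\<close>
  have "\<exists>K. \<forall>x \<in> PiE I S. norm (Z (x(i := a))) \<le> K"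
  proof (rule insert.IH)
    fix x j y' assume x: "x \<in> PiE I S" "j \<in> I" "y' \<in> S j"
    then have "x(i := a) \<in> PiE (insert i I) S"
      using a by (intro PiE_fun_upd)
    moreover have "x(j := y', i := a) = x(i := a, j := y')"
      using x insert.hyps by (intro fun_upd_twist) auto
    ultimately show "norm (Z (x(i := a)) - Z (x(j := y', i := a))) \<le> c j"
      using insert.prems[of "x(i := a)" j y'] x by (simp del: fun_upd_apply)
  qed
  then obtain K where K: "\<And>x. x \<in> PiE I S \<Longrightarrow> norm (Z (x(i := a))) \<le> K"
    by blast
  have "norm (Z y) \<le> c i + K" if y: "y \<in> PiE (insert i I) S" for y
  proof -
    have "norm (Z y - Z (y(i := a))) \<le> c i"
      using insert.prems[OF y _ a] by (simp del: fun_upd_apply)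
    \<comment> \<open>Points of \<open>PiE I S\<close> take the value \<open>undefined\<close>
      outside \<open>I\<close>, so resetting \<open>y\<close> at \<open>i\<close> gives the point
      whose update by \<open>a\<close> is \<open>y(i := a)\<close>.\<close>
    moreover have "norm (Z (y(i := a))) \<le> K"
      using K[of "y(i := undefined)"] y insert.hyps by (auto simp: PiE_iff extensional_def)
    ultimately show ?thesis
      using norm_triangle_sub[of "Z y" "Z (y(i := a))"] by linarith
  qed
  then show ?case by blast
qed

lemma bounded_on_PiM_of_bounded_differences:
  fixes Z :: "('i \<Rightarrow> 'a) \<Rightarrow> 'b::real_normed_vector"
  assumes prob: "\<And>i. prob_space (M i)" and "finite I"
    and diff: "\<And>y j y'. y \<in> space (PiM I M) \<Longrightarrow> j \<in> I \<Longrightarrow> y' \<in> space (M j)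
      \<Longrightarrow> norm (Z y - Z (y(j := y'))) \<le> c j"
  shows "\<exists>K. \<forall>y \<in> space (PiM I M). norm (Z y) \<le> K"
  unfolding space_PiM
  by (rule bounded_on_PiE_of_bounded_differences[OF \<open>finite I\<close>, where c = c])
    (auto simp: prob_space.not_empty[OF prob] space_PiM[symmetric] intro: diff)

lemma square_integrable_PiM_of_bounded_differences:
  fixes Z :: "('i \<Rightarrow> 'a) \<Rightarrow> 'b::euclidean_space"
  assumes prob: "\<And>i. prob_space (M i)" and "finite I"
    and [measurable]: "Z \<in> borel_measurable (PiM I M)"
    and diff: "\<And>y j y'. y \<in> space (PiM I M) \<Longrightarrow> j \<in> I \<Longrightarrow> y' \<in> space (M j)
      \<Longrightarrow> norm (Z y - Z (y(j := y'))) \<le> c j"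
  shows "integrable (PiM I M) (\<lambda>y. (norm (Z y))\<^sup>2)"
proof -
  interpret prob_space "PiM I M"
    by (rule prob_space_PiM[OF prob])
  obtain K where K: "\<And>y. y \<in> space (PiM I M) \<Longrightarrow> norm (Z y) \<le> K"
    using bounded_on_PiM_of_bounded_differences[of M I Z c, OF prob \<open>finite I\<close> diff] by blast
  show ?thesis
    by (rule integrable_const_bound[where B = "K\<^sup>2"]) (auto intro!: AE_I2 power_mono K)
qed

text \<open>With the variance written as a difference of two terms, Fubini acts on each term
  separately and the total variance identity becomes a cancellation. The induction keeps
  \<open>Z\<close> arbitrary because its hypothesis is used for the partial mean over one
  coordinate.\<close>

theorem Efron_Stein_bounded_differences:
  fixes Z :: "('i \<Rightarrow> 'a) \<Rightarrow> 'b::euclidean_space"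
  assumes prob: "\<And>i. prob_space (M i)" and "finite I"
    and "Z \<in> borel_measurable (PiM I M)"
    and "\<And>y j y'. y \<in> space (PiM I M) \<Longrightarrow> j \<in> I \<Longrightarrow> y' \<in> space (M j)
      \<Longrightarrow> norm (Z y - Z (y(j := y'))) \<le> c j"
  shows "(\<integral>y. (norm (Z y))\<^sup>2 \<partial>PiM I M) - (norm (\<integral>y. Z y \<partial>PiM I M))\<^sup>2 \<le> (\<Sum>j\<in>I. (c j)\<^sup>2) / 2"
  using assms(2-)
proof (induction I arbitrary: Z rule: finite_induct)
  \<comment> \<open>The empty product has one point, so the single-space bound applies with
    difference \<open>0\<close>.\<close>
  case empty
  interpret prob_space "PiM {} M"
    by (rule prob_space_PiM[OF prob])
  show ?case
    using mean_sq_dev_le_of_bounded_difference[OF empty.prems(1), of 0]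
      square_integrable_PiM_of_bounded_differences[OF prob _ empty.prems]
    by (auto simp: space_PiM)
next
  case (insert i I)
  interpret product_sigma_finite M
    unfolding product_sigma_finite_def by (blast intro: prob_space_imp_sigma_finite prob)
  interpret i: prob_space "M i"
    by (rule prob)
  interpret I: prob_space "PiM I M"
    by (rule prob_space_PiM[OF prob])
  interpret iI: prob_space "PiM (insert i I) M"
    by (rule prob_space_PiM[OF prob])
  note [measurable] = insert.prems(1)
  have Zsq: "integrable (PiM (insert i I) M) (\<lambda>y. (norm (Z y))\<^sup>2)"
    using insert.hyps
    by (intro square_integrable_PiM_of_bounded_differences[OF prob _ insert.prems]) auto
  have Zint: "integrable (PiM (insert i I) M) Z"
    by (rule iI.integrable_of_square_integrable[OF insert.prems(1) Zsq])
  have upd_space: "x(i := y) \<in> space (PiM (insert i I) M)"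
    if "x \<in> space (PiM I M)" "y \<in> space (M i)" for x y
    using that unfolding space_PiM by (intro PiE_fun_upd)
  \<comment> \<open>This uniform bound makes every fibre of \<open>Z\<close> square integrable, and
    also the second moment of the fibre as a function of the remaining coordinates.\<close>
  obtain K where K: "\<And>y. y \<in> space (PiM (insert i I) M) \<Longrightarrow> norm (Z y) \<le> K"
    using bounded_on_PiM_of_bounded_differences[of M "insert i I" Z c, OF prob _ insert.prems(2)]
      insert.hyps by blast
  \<comment> \<open>\<open>h\<close> is the conditional mean of \<open>Z\<close> given all
    coordinates other than \<open>i\<close>.\<close>
  define h where "h x = (\<integral>y. Z (x(i := y)) \<partial>M i)" for x
  have meas: "(\<lambda>(x, y). Z (x(i := y))) \<in> borel_measurable (PiM I M \<Otimes>\<^sub>M M i)"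
    using measurable_compose[OF measurable_add_dim insert.prems(1)]
    by (simp add: case_prod_unfold)
  have h[measurable]: "h \<in> borel_measurable (PiM I M)"
    unfolding h_def by (rule M.borel_measurable_lebesgue_integral[OF meas])
  have "(\<lambda>(x, y). (norm (Z (x(i := y))))\<^sup>2) \<in> borel_measurable (PiM I M \<Otimes>\<^sub>M M i)"
    using meas unfolding case_prod_unfold by measurable
  then have qmeas: "(\<lambda>x. \<integral>y. (norm (Z (x(i := y))))\<^sup>2 \<partial>M i) \<in> borel_measurable (PiM I M)"
    by (rule M.borel_measurable_lebesgue_integral)
  have fib: "(\<lambda>y. Z (x(i := y))) \<in> borel_measurable (M i)" if "x \<in> space (PiM I M)" for x
    using measurable_compose[OF measurable_Pair1'[OF that] meas] by simp
  have fib_sq: "integrable (M i) (\<lambda>y. (norm (Z (x(i := y))))\<^sup>2)" if "x \<in> space (PiM I M)" for x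
    by (rule i.integrable_const_bound[where B = "K\<^sup>2"])
      (use fib[OF that] in \<open>auto intro!: AE_I2 power_mono K upd_space that\<close>)
  have fib_int: "integrable (M i) (\<lambda>y. Z (x(i := y)))" if "x \<in> space (PiM I M)" for x
    by (rule i.integrable_of_square_integrable[OF fib[OF that] fib_sq[OF that]])
  \<comment> \<open>Averaging over coordinate \<open>i\<close> preserves the bound
    \<open>c j\<close>: the norm of a mean is at most the mean of the norms, and
    \<open>j \<noteq> i\<close> lets the two updates be exchanged.\<close>
  have hdiff: "norm (h x - h (x(j := y'))) \<le> c j"
    if x: "x \<in> space (PiM I M)" and j: "j \<in> I" and y': "y' \<in> space (M j)" for x j y'
  proof -
    have x': "x(j := y') \<in> space (PiM I M)"
      using x j y' by (auto simp: space_PiM PiE_iff extensional_def)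
    have "h x - h (x(j := y')) = (\<integral>y. Z (x(i := y)) - Z (x(j := y', i := y)) \<partial>M i)"
      unfolding h_def using fib_int[OF x] fib_int[OF x'] by simp
    also have "norm \<dots> \<le> (\<integral>y. norm (Z (x(i := y)) - Z (x(j := y', i := y))) \<partial>M i)"
      by (rule integral_norm_bound)
    also have "\<dots> \<le> c j"
    proof (rule i.integral_le_const)
      show "AE y in M i. norm (Z (x(i := y)) - Z (x(j := y', i := y))) \<le> c j"
      proof (rule AE_I2)
        fix y assume y: "y \<in> space (M i)"
        have "x(j := y', i := y) = x(i := y, j := y')"
          using j insert.hyps by (intro fun_upd_twist) auto
        then show "norm (Z (x(i := y)) - Z (x(j := y', i := y))) \<le> c j"
          using insert.prems(2)[OF upd_space[OF x y] _ y'] j by (simp del: fun_upd_apply)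
      qed
    qed (use fib_int[OF x] fib_int[OF x'] in simp)
    finally show ?thesis .
  qed
  have hsq: "integrable (PiM I M) (\<lambda>x. (norm (h x))\<^sup>2)"
    by (rule square_integrable_PiM_of_bounded_differences[OF prob insert.hyps(1) h hdiff])
  \<comment> \<open>This is the conditional variance along one fibre, where only coordinate
    \<open>i\<close> moves.\<close>
  have inner: "(\<integral>y. (norm (Z (x(i := y))))\<^sup>2 \<partial>M i) - (norm (h x))\<^sup>2 \<le> (c i)\<^sup>2 / 2"
    if x: "x \<in> space (PiM I M)" for x
    unfolding h_def
  proof (rule i.mean_sq_dev_le_of_bounded_difference[OF fib[OF x] fib_sq[OF x]])
    fix y y' assume "y \<in> space (M i)" "y' \<in> space (M i)"
    then show "norm (Z (x(i := y)) - Z (x(i := y'))) \<le> c i"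
      using insert.prems(2)[OF upd_space[OF x], of y i y'] by (simp del: fun_upd_apply)
  qed
  have qint: "integrable (PiM I M) (\<lambda>x. \<integral>y. (norm (Z (x(i := y))))\<^sup>2 \<partial>M i)"
  proof (rule I.integrable_const_bound[where B = "K\<^sup>2"], rule AE_I2)
    fix x assume x: "x \<in> space (PiM I M)"
    have "(\<integral>y. (norm (Z (x(i := y))))\<^sup>2 \<partial>M i) \<le> K\<^sup>2"
      by (rule i.integral_le_const[OF fib_sq[OF x]])
        (auto intro!: AE_I2 power_mono K upd_space x)
    then show "norm (\<integral>y. (norm (Z (x(i := y))))\<^sup>2 \<partial>M i) \<le> K\<^sup>2"
      by simp
  qed (rule qmeas)
  \<comment> \<open>Law of total variance: after Fubini, the mean of the squared norm of
    \<open>h\<close> is subtracted in the first summand and added back in the second. The fibre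
    bound controls the first summand, the induction hypothesis for \<open>h\<close> the
    second.\<close>
  have "(\<integral>y. (norm (Z y))\<^sup>2 \<partial>PiM (insert i I) M) - (norm (\<integral>y. Z y \<partial>PiM (insert i I) M))\<^sup>2 =
      (\<integral>x. (\<integral>y. (norm (Z (x(i := y))))\<^sup>2 \<partial>M i) - (norm (h x))\<^sup>2 \<partial>PiM I M) +
      ((\<integral>x. (norm (h x))\<^sup>2 \<partial>PiM I M) - (norm (\<integral>x. h x \<partial>PiM I M))\<^sup>2)"
    unfolding product_integral_insert[OF insert.hyps Zsq] product_integral_insert[OF insert.hyps Zint]
      h_def[symmetric]
    using qint hsq by simp
  also have "\<dots> \<le> (c i)\<^sup>2 / 2 + (\<Sum>j\<in>I. (c j)\<^sup>2) / 2"
    by (intro add_mono I.integral_le_const insert.IH h hdiff AE_I2 inner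
        Bochner_Integration.integrable_diff qint hsq)
  finally show ?case
    using insert.hyps by (simp add: add_divide_distrib)
qed

section \<open>Transport, scaling and addition of variance bounds\<close>

text \<open>Change of variables carries a bound assumed under the law of a rollout group over to the
  outcome space on which the whole batch is sampled.\<close>

lemma variance_le_distr:
  assumes Y: "Y \<in> measurable P N" and f: "f \<in> borel_measurable N"
    and var: "variance_le (distr P N Y) f c"
  shows "variance_le P (\<lambda>w. f (Y w)) c"
  using var measurable_compose[OF Y f] f
  by (simp add: variance_le_def mean_sq_dev_def integrable_distr_eq[OF Y] integral_distr[OF Y])

lemma variance_le_scaleR:
  assumes "variance_le P Z c"
  shows "variance_le P (\<lambda>w. a *\<^sub>R Z w) (a\<^sup>2 * c)"
proof -
  have *: "(norm (a *\<^sub>R z))\<^sup>2 = a\<^sup>2 * (norm z)\<^sup>2" for z :: "real ^ 'b"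
    by (simp add: power_mult_distrib)
  show ?thesis
    using assms borel_measurable_scaleR[OF borel_measurable_const, of Z P a]
    unfolding variance_le_def mean_sq_dev_def
    by (simp add: * scaleR_diff_right[symmetric] mult_left_mono del: norm_scaleR)
qed

lemma variance_le_sum_indep:
  assumes "prob_space P" and indep: "prob_space.indep_vars P (\<lambda>_. borel) Z I" and "finite I"
    and var: "\<And>i. i \<in> I \<Longrightarrow> variance_le P (Z i) (c i)"
  shows "variance_le P (\<lambda>w. \<Sum>i\<in>I. Z i w) (\<Sum>i\<in>I. c i)"
proof -
  interpret prob_space P by fact
  have meas: "Z i \<in> borel_measurable P" and sq: "integrable P (\<lambda>w. (norm (Z i w))\<^sup>2)"
    and le: "mean_sq_dev P (Z i) \<le> c i" if "i \<in> I" for i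
    using var[OF that] by (auto simp: variance_le_def)
  have "mean_sq_dev P (\<lambda>w. \<Sum>i\<in>I. Z i w) = (\<Sum>i\<in>I. mean_sq_dev P (Z i))"
    unfolding mean_sq_dev_def by (rule mean_sq_dev_sum_indep[OF indep \<open>finite I\<close> sq])
  also have "\<dots> \<le> (\<Sum>i\<in>I. c i)"
    by (rule sum_mono[OF le])
  finally show ?thesis
    using meas square_integrable_sum[OF meas sq] by (simp add: variance_le_def)
qed

lemma variance_le_PiM_of_bounded_differences:
  assumes prob: "\<And>i. prob_space (M i)" and "finite I" and Z: "Z \<in> borel_measurable (PiM I M)"
    and diff: "\<And>y j y'. y \<in> space (PiM I M) \<Longrightarrow> j \<in> I \<Longrightarrow> y' \<in> space (M j)
      \<Longrightarrow> norm (Z y - Z (y(j := y'))) \<le> c j"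
  shows "variance_le (PiM I M) Z ((\<Sum>j\<in>I. (c j)\<^sup>2) / 2)"
proof -
  interpret prob_space "PiM I M"
    by (rule prob_space_PiM[OF prob])
  have sq: "integrable (PiM I M) (\<lambda>y. (norm (Z y))\<^sup>2)"
    by (rule square_integrable_PiM_of_bounded_differences[OF assms])
  have "mean_sq_dev (PiM I M) Z = expectation (\<lambda>y. (norm (Z y))\<^sup>2) - (norm (expectation Z))\<^sup>2"
    unfolding mean_sq_dev_def mean_sq_diff_const[OF Z sq] by (simp add: power2_norm_eq_inner)
  also have "\<dots> \<le> (\<Sum>j\<in>I. (c j)\<^sup>2) / 2"
    by (rule Efron_Stein_bounded_differences[OF assms])
  finally show ?thesis
    using Z sq by (simp add: variance_le_def)
qed

section \<open>Variance of the per-prompt gradient and of the batch gradient\<close>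

text \<open>Efron-Stein over \<open>m\<close> i.i.d. rollouts with every difference equal to
  \<open>C / real m\<close>: the \<open>m\<close> summands \<open>(C / real m)\<^sup>2\<close> add
  up to \<open>C\<^sup>2 / real m\<close>, which is then halved.\<close>

lemma variance_le_ghat_of_bounded_differences:
  assumes model: "rollout_sampling_model R \<pi> Q loss \<theta>"
    and diff: "bounded_differences R loss g \<theta> b C" and "g x = b" and "0 < m"
  shows "variance_le (Q \<theta> x m) (ghat loss x \<theta> m) ((C\<^sup>2 / 2) / real m)"
proof -
  have prob: "prob_space (\<pi> \<theta> x)" and sets: "sets (\<pi> \<theta> x) = sets R"
    and Q: "Q \<theta> x m = PiM {1..m} (\<lambda>_. \<pi> \<theta> x)"
    using model \<open>0 < m\<close> by (auto simp: rollout_sampling_model_def)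
  have sets_Q: "sets (Q \<theta> x m) = sets (group_space R m)"
    unfolding Q group_space_def by (intro sets_PiM_cong refl sets)
  have "variance_le (PiM {1..m} (\<lambda>_. \<pi> \<theta> x)) (ghat loss x \<theta> m) ((\<Sum>j\<in>{1..m}. (C / real m)\<^sup>2) / 2)"
  proof (rule variance_le_PiM_of_bounded_differences)
    show "ghat loss x \<theta> m \<in> borel_measurable (PiM {1..m} (\<lambda>_. \<pi> \<theta> x))"
      using diff assms(3,4) measurable_cong_sets[OF sets_Q refl]
      by (auto simp: bounded_differences_def Q)
  next
    fix y j y' assume "y \<in> space (PiM {1..m} (\<lambda>_. \<pi> \<theta> x))" "j \<in> {1..m}" "y' \<in> space (\<pi> \<theta> x)"
    then show "norm (ghat loss x \<theta> m y - ghat loss x \<theta> m (y(j := y'))) \<le> C / real m"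
      using diff assms(3,4) sets_eq_imp_space_eq[OF sets_Q] sets_eq_imp_space_eq[OF sets]
      unfolding bounded_differences_def Q by blast
  qed (use prob in auto)
  also have "(\<Sum>j\<in>{1..m}. (C / real m)\<^sup>2) / 2 = (C\<^sup>2 / 2) / real m"
    using \<open>0 < m\<close> by (simp add: power2_eq_square field_simps)
  finally show ?thesis
    by (simp add: Q)
qed

text \<open>Exchange the two sums: each prompt lies in exactly one of the bins \<open>1..B\<close>,
  so the inner sum over bins picks out one term.\<close>

lemma sum_bin_freq:
  assumes "\<And>x. g x \<in> {1..B}"
  shows "(\<Sum>b=1..B. bin_freq M g xs b * u b) = (1 / real M) * (\<Sum>i=1..M. u (g (xs i)))"
proof -
  have "bin_freq M g xs b * u b = (1 / real M) * (\<Sum>i=1..M. if g (xs i) = b then u b else 0)" for b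
    by (simp add: bin_freq_def sum_distrib_right if_distrib[of "\<lambda>z. z * u b"] cong: if_cong)
  then have "(\<Sum>b=1..B. bin_freq M g xs b * u b)
      = (1 / real M) * (\<Sum>b=1..B. \<Sum>i=1..M. if g (xs i) = b then u b else 0)"
    by (simp only: sum_distrib_left)
  also have "(\<Sum>b=1..B. \<Sum>i=1..M. if g (xs i) = b then u b else 0) = (\<Sum>i=1..M. u (g (xs i)))"
    using assms by (subst sum.swap) simp
  finally show ?thesis .
qed

lemma variance_le_batch_grad:
  assumes bins: "\<And>x. g x \<in> {1..B}"
    and law: "group_law R Q" and counts: "\<And>b. b \<in> {1..B} \<Longrightarrow> 0 < n b"
    and P: "prob_space P"
    and groups: "\<And>i. i \<in> {1..M} \<Longrightarrow>
      distr P (group_space R (n (g (xs i)))) (Y i) = Q \<theta> (xs i) (n (g (xs i)))"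
    and indep: "prob_space.indep_vars P (\<lambda>i. group_space R (n (g (xs i)))) Y {1..M}"
    and var: "\<And>x. variance_le (Q \<theta> x (n (g x))) (ghat loss x \<theta> (n (g x))) (v (g x) / real (n (g x)))"
  shows "variance_le P (batch_grad loss M g xs \<theta> n Y)
    ((1 / real M) * (\<Sum>b=1..B. bin_freq M g xs b * (v b / real (n b))))"
proof -
  interpret prob_space P by fact
  let ?G = "\<lambda>i. ghat loss (xs i) \<theta> (n (g (xs i)))"
  \<comment> \<open>The variance bound gives measurability with respect to \<open>Q\<close>, whose
    sigma-algebra is that of the group space. It is needed there for independence to pass from the
    groups \<open>Y i\<close> to the gradients.\<close>
  have G: "?G i \<in> borel_measurable (group_space R (n (g (xs i))))" for i
  proof -
    have "sets (Q \<theta> (xs i) (n (g (xs i)))) = sets (group_space R (n (g (xs i))))"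
      using law counts[OF bins] by (auto simp: group_law_def)
    then show ?thesis
      using var[of "xs i"] measurable_cong_sets by (auto simp: variance_le_def)
  qed
  have "variance_le P (\<lambda>w. ?G i (Y i w)) (v (g (xs i)) / real (n (g (xs i))))"
    if i: "i \<in> {1..M}" for i
  proof (rule variance_le_distr[OF _ G])
    show "Y i \<in> measurable P (group_space R (n (g (xs i))))"
      using indep i by (simp add: indep_vars_def)
    show "variance_le (distr P (group_space R (n (g (xs i)))) (Y i)) (?G i)
        (v (g (xs i)) / real (n (g (xs i))))"
      unfolding groups[OF i] by (rule var)
  qed
  then have "variance_le P (\<lambda>w. \<Sum>i=1..M. ?G i (Y i w)) (\<Sum>i=1..M. v (g (xs i)) / real (n (g (xs i))))"
    by (intro variance_le_sum_indep[OF P indep_vars_compose2[OF indep G]]) simp_all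
  \<comment> \<open>Scaling contributes \<open>(1 / real M)\<^sup>2\<close>; one factor
    \<open>1 / real M\<close> is absorbed into the bin frequencies and the other remains in
    front.\<close>
  from variance_le_scaleR[OF this, of "1 / real M"]
  show ?thesis
    unfolding sum_bin_freq[OF bins, where u = "\<lambda>b. v b / real (n b)"] batch_grad_def[abs_def]
    by (simp add: power2_eq_square)
qed

theorem lemmaB15:
  fixes R :: "'r measure"
    and \<pi> :: "real ^ 'd \<Rightarrow> 'p \<Rightarrow> 'r measure"
    and Q :: "real ^ 'd \<Rightarrow> 'p \<Rightarrow> nat \<Rightarrow> (nat \<Rightarrow> 'r) measure"
    and loss :: "'p \<Rightarrow> real ^ 'd \<Rightarrow> nat \<Rightarrow> (nat \<Rightarrow> 'r) \<Rightarrow> real"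
    and \<theta> :: "real ^ 'd"
    and M B :: nat
    and xs :: "nat \<Rightarrow> 'p"
    and g :: "'p \<Rightarrow> nat"
    and n :: "nat \<Rightarrow> nat"
    and P :: "'w measure"
    and Y :: "nat \<Rightarrow> 'w \<Rightarrow> nat \<Rightarrow> 'r"
  assumes M: "0 < M"
    and bins: "\<And>x. g x \<in> {1..B}"
    and counts: "\<And>b. b \<in> {1..B} \<Longrightarrow> 0 < n b"
    and law: "group_law R Q"
    \<comment> \<open>\<open>P\<close> is the conditional law of the sampled groups given the batch prompts \<open>xs 1, \<dots>, xs M\<close>.\<close>
    and P: "prob_space P"
    and groups: "\<And>i. i \<in> {1..M} \<Longrightarrow>
      distr P (group_space R (n (g (xs i)))) (Y i) = Q \<theta> (xs i) (n (g (xs i)))"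
    and indep: "prob_space.indep_vars P (\<lambda>i. group_space R (n (g (xs i)))) Y {1..M}"
  shows "(\<forall>v :: nat \<Rightarrow> real.
            (\<forall>b\<in>{1..B}. \<forall>x. g x = b \<longrightarrow>
               variance_le (Q \<theta> x (n b)) (ghat loss x \<theta> (n b)) (v b / real (n b))) \<longrightarrow>
            variance_le P (batch_grad loss M g xs \<theta> n Y)
              ((1 / real M) * (\<Sum>b=1..B. bin_freq M g xs b * (v b / real (n b)))))
       \<and> (\<forall>C :: nat \<Rightarrow> real.
            rollout_sampling_model R \<pi> Q loss \<theta> \<longrightarrow>
            (\<forall>b\<in>{1..B}. bounded_differences R loss g \<theta> b (C b)) \<longrightarrow>
            (\<forall>b\<in>{1..B}. \<forall>x. g x = b \<longrightarrow>
               variance_le (Q \<theta> x (n b)) (ghat loss x \<theta> (n b)) (((C b)\<^sup>2 / 2) / real (n b))) \<and>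
            variance_le P (batch_grad loss M g xs \<theta> n Y)
              ((1 / real M) * (\<Sum>b=1..B. bin_freq M g xs b * (((C b)\<^sup>2 / 2) / real (n b)))))"
proof (intro conjI allI impI)
  fix v :: "nat \<Rightarrow> real"
  assume "\<forall>b\<in>{1..B}. \<forall>x. g x = b \<longrightarrow>
    variance_le (Q \<theta> x (n b)) (ghat loss x \<theta> (n b)) (v b / real (n b))"
  then show "variance_le P (batch_grad loss M g xs \<theta> n Y)
      ((1 / real M) * (\<Sum>b=1..B. bin_freq M g xs b * (v b / real (n b))))"
    using bins by (intro variance_le_batch_grad[OF bins law counts P groups indep]) auto
next
  fix C :: "nat \<Rightarrow> real"
  assume model: "rollout_sampling_model R \<pi> Q loss \<theta>"
    and diff: "\<forall>b\<in>{1..B}. bounded_differences R loss g \<theta> b (C b)"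
  \<comment> \<open>This is the hypothesis of the general bound for the choice
    \<open>v b = (C b)\<^sup>2 / 2\<close>, so both remaining claims follow from it.\<close>
  have var: "variance_le (Q \<theta> x (n (g x))) (ghat loss x \<theta> (n (g x)))
      (((C (g x))\<^sup>2 / 2) / real (n (g x)))" for x
    using diff bins counts[OF bins]
    by (intro variance_le_ghat_of_bounded_differences[OF model]) auto
  then show "\<forall>b\<in>{1..B}. \<forall>x. g x = b \<longrightarrow>
      variance_le (Q \<theta> x (n b)) (ghat loss x \<theta> (n b)) (((C b)\<^sup>2 / 2) / real (n b))"
    by blast
  show "variance_le P (batch_grad loss M g xs \<theta> n Y)
      ((1 / real M) * (\<Sum>b=1..B. bin_freq M g xs b * (((C b)\<^sup>2 / 2) / real (n b))))"
    by (rule variance_le_batch_grad[OF bins law counts P groups indep var])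
qed

end
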